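(* Let $A$ be a commutative ring, let $g_1,g_2,\ldots,g_n$ be $n$ elements of $A$, and let $c_1,c_2,\ldots,c_n$ be $n$ further elements of $A$. Assume that $$\sum_{i=1}^{n} c_i g_i^{k}=0\qquad\text{for all } k\in\mathbb{N}.$$ Then $$c_i\prod_{j\neq i}(g_i-g_j)=0\qquad\text{for all } i\in\{1,2,\ldots,n\},$$ where the product ranges over all $j\in\{1,2,\ldots,n\}$ with $j\neq i$.
   Context: $\mathbb{N}=\{0,1,2,\ldots\}$. Rings are associative and have a unity; $g^0=1$. *)

theory Defs
  imports "HOL-Algebra.Ring"
begin

end

theory Submission
  imports Defs
begin

text \<open>
  Regard the hypothesis as saying that the functional \<open>p \<mapsto> \<Sum>\<^sub>i c\<^sub>i p(g\<^sub>i)\<close> kills every monomial,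
  hence every polynomial \<open>p\<close> over \<open>A\<close>. Evaluated at \<open>p = \<Prod>\<^bsub>j \<noteq> i\<^esub> (X - g\<^sub>j)\<close>, which vanishes at
  every node except possibly \<open>g\<^sub>i\<close>, it leaves exactly the claimed term. Since this polynomial is a
  product of linear factors, polynomials can be avoided: replacing the weights \<open>c\<^sub>i\<close> by
  \<open>c\<^sub>i (g\<^sub>i - a)\<close> again gives weights all of whose power sums vanish
  (\<open>weighted_power_sums_zero_linear_factor\<close>), and iterating this inserts the product one
  factor at a time (\<open>weighted_power_sums_zero_prod\<close>). The argument never divides by a
  difference \<open>g\<^sub>i - g\<^sub>j\<close>, so it works in any commutative ring.
\<close>

context cring
begin

lemma finprod_zero_factor:
  assumes "finite J" "f \<in> J \<rightarrow> carrier R" "j \<in> J" "f j = \<zero>"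
  shows "finprod R f J = \<zero>"
proof -
  have "finprod R f J = finprod R f (insert j (J - {j}))"
    using assms(3) by (simp add: insert_absorb)
  also have "\<dots> = f j \<otimes> finprod R f (J - {j})"
    using assms by (intro finprod_insert) auto
  also have "\<dots> = \<zero>"
    using assms(2,4) by (simp add: Pi_iff)
  finally show ?thesis .
qed

text \<open>
  Expanding the factor \<open>g\<^sub>i - a\<close> writes the \<open>k\<close>-th power sum for the new weights as the
  \<open>(k+1)\<close>-st old one minus \<open>a\<close> times the \<open>k\<close>-th old one.
\<close>
lemma weighted_power_sums_zero_linear_factor:
  assumes g: "g \<in> I \<rightarrow> carrier R" and c: "c \<in> I \<rightarrow> carrier R" and a: "a \<in> carrier R"
    and zero: "\<And>k::nat. (\<Oplus>i\<in>I. c i \<otimes> g i [^] k) = \<zero>"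
  shows "(\<Oplus>i\<in>I. (c i \<otimes> (g i \<ominus> a)) \<otimes> g i [^] (k::nat)) = \<zero>"
proof (cases "finite I")
  case True
  have expand: "(c i \<otimes> (g i \<ominus> a)) \<otimes> g i [^] k
      = c i \<otimes> g i [^] Suc k \<oplus> (\<ominus> a) \<otimes> (c i \<otimes> g i [^] k)" if "i \<in> I" for i
  proof -
    have [simp]: "g i \<in> carrier R" "c i \<in> carrier R"
      using that g c by auto
    have "g i [^] k \<in> carrier R" by simp
    then show ?thesis
      using a by (simp add: minus_eq l_distr r_distr m_ac l_minus r_minus)
  qed
  have "(\<Oplus>i\<in>I. (c i \<otimes> (g i \<ominus> a)) \<otimes> g i [^] k)
      = (\<Oplus>i\<in>I. c i \<otimes> g i [^] Suc k \<oplus> (\<ominus> a) \<otimes> (c i \<otimes> g i [^] k))"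
    using g c a by (intro finsum_cong' refl expand) (auto simp: Pi_iff)
  also have "\<dots> = (\<Oplus>i\<in>I. c i \<otimes> g i [^] Suc k) \<oplus> (\<Oplus>i\<in>I. (\<ominus> a) \<otimes> (c i \<otimes> g i [^] k))"
    using g c a by (intro finsum_addf) (auto simp: Pi_iff)
  also have "(\<Oplus>i\<in>I. (\<ominus> a) \<otimes> (c i \<otimes> g i [^] k)) = (\<ominus> a) \<otimes> (\<Oplus>i\<in>I. c i \<otimes> g i [^] k)"
    using g c a True by (intro finsum_rdistr [symmetric]) auto
  finally show ?thesis
    unfolding zero using a by simp
qed (simp add: finsum_infinite)

text \<open>
  The induction runs over all exponents \<open>k\<close> at once, because passing to one more factor uses
  the vanishing for both \<open>k\<close> and \<open>k+1\<close>.
\<close>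
lemma weighted_power_sums_zero_prod:
  assumes g: "g \<in> I \<rightarrow> carrier R" and c: "c \<in> I \<rightarrow> carrier R"
    and zero: "\<And>k::nat. (\<Oplus>i\<in>I. c i \<otimes> g i [^] k) = \<zero>"
    and "finite J" and "h \<in> J \<rightarrow> carrier R"
  shows "(\<Oplus>i\<in>I. (c i \<otimes> (\<Otimes>j\<in>J. g i \<ominus> h j)) \<otimes> g i [^] (k::nat)) = \<zero>"
  using assms(4,5)
proof (induction J arbitrary: k rule: finite_induct)
  case empty
  have "(\<Oplus>i\<in>I. (c i \<otimes> (\<Otimes>j\<in>{}. g i \<ominus> h j)) \<otimes> g i [^] k) = (\<Oplus>i\<in>I. c i \<otimes> g i [^] k)"
    using g c by (intro finsum_cong') (auto simp: Pi_iff)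
  then show ?case by (simp add: zero)
next
  case (insert m J)
  have h: "h m \<in> carrier R" "h \<in> J \<rightarrow> carrier R"
    using insert.prems by auto
  let ?d = "\<lambda>i. c i \<otimes> (\<Otimes>j\<in>J. g i \<ominus> h j)"
  have P: "(\<Otimes>j\<in>J. g i \<ominus> h j) \<in> carrier R" if "i \<in> I" for i
    using that g h by (intro finprod_closed) auto
  have d: "?d \<in> I \<rightarrow> carrier R"
    using c P by auto
  have step: "c i \<otimes> (\<Otimes>j\<in>insert m J. g i \<ominus> h j) = ?d i \<otimes> (g i \<ominus> h m)" if i: "i \<in> I" for i
  proof -
    have gi: "g i \<in> carrier R" and ci: "c i \<in> carrier R"
      using i g c by auto
    have "(\<Otimes>j\<in>insert m J. g i \<ominus> h j) = (g i \<ominus> h m) \<otimes> (\<Otimes>j\<in>J. g i \<ominus> h j)"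
      using insert.hyps h gi by (intro finprod_insert) auto
    then show ?thesis
      using P [OF i] gi ci h by (simp add: m_ac)
  qed
  have "(\<Oplus>i\<in>I. (c i \<otimes> (\<Otimes>j\<in>insert m J. g i \<ominus> h j)) \<otimes> g i [^] k)
      = (\<Oplus>i\<in>I. (?d i \<otimes> (g i \<ominus> h m)) \<otimes> g i [^] k)"
    using g c h P by (intro finsum_cong') (auto simp: step Pi_iff)
  also have "\<dots> = \<zero>"
    using weighted_power_sums_zero_linear_factor [OF g d h(1) insert.IH [OF h(2)]] .
  finally show ?case .
qed

end

theorem theorem3p1:
  fixes A (structure) and n :: nat and g c :: "nat \<Rightarrow> 'a"
  assumes "cring A"
    and "\<And>i. i \<in> {1..n} \<Longrightarrow> g i \<in> carrier A"
    and "\<And>i. i \<in> {1..n} \<Longrightarrow> c i \<in> carrier A"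
    and "\<And>k::nat. (\<Oplus>\<^bsub>A\<^esub>i\<in>{1..n}. c i \<otimes>\<^bsub>A\<^esub> g i [^]\<^bsub>A\<^esub> k) = \<zero>\<^bsub>A\<^esub>"
  shows "\<forall>i\<in>{1..n}. c i \<otimes>\<^bsub>A\<^esub> (\<Otimes>\<^bsub>A\<^esub>j\<in>{1..n} - {i}. g i \<ominus>\<^bsub>A\<^esub> g j) = \<zero>\<^bsub>A\<^esub>"
proof
  interpret cring A by fact
  fix i assume i: "i \<in> {1..n}"
  have g: "g \<in> {1..n} \<rightarrow> carrier A" and c: "c \<in> {1..n} \<rightarrow> carrier A"
    using assms(2,3) by auto
  let ?t = "\<lambda>l. c l \<otimes> (\<Otimes>j\<in>{1..n} - {i}. g l \<ominus> g j)"
  have t: "?t l \<in> carrier A" if "l \<in> {1..n}" for l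
    using that assms(2,3) by (intro m_closed finprod_closed) auto
  have "\<zero> = (\<Oplus>l\<in>{1..n}. ?t l \<otimes> g l [^] (0::nat))"
    using g by (intro weighted_power_sums_zero_prod [OF g c assms(4), symmetric]) auto
  also have "\<dots> = (\<Oplus>l\<in>{1..n}. if i = l then ?t l else \<zero>)"
  proof (rule finsum_cong' [OF refl])
    show "(\<lambda>l. if i = l then ?t l else \<zero>) \<in> {1..n} \<rightarrow> carrier A"
      using t by auto
    show "?t l \<otimes> g l [^] (0::nat) = (if i = l then ?t l else \<zero>)" if l: "l \<in> {1..n}" for l
    proof (cases "i = l")
      case True
      then show ?thesis using t [OF l] by simp
    next
      case False
      \<comment> \<open>The factor with \<open>j = l\<close> is \<open>g\<^sub>l - g\<^sub>l\<close>.\<close>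
      have "(\<Otimes>j\<in>{1..n} - {i}. g l \<ominus> g j) = \<zero>"
        using l False assms(2) by (intro finprod_zero_factor [where j = l]) (auto simp: r_neg minus_eq)
      then show ?thesis using False l assms(3) by simp
    qed
  qed
  also have "\<dots> = ?t i"
    using i t by (intro finsum_singleton) auto
  finally show "?t i = \<zero>" by simp
qed

end
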